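(* Let $\lambda<0$ and let $n\ge2$ be an integer. Suppose $\rho_0\in D^0$, $\rho_0\ge0$, is not identically zero and $v_0\in D^1$ satisfies $v_0(0)=0$. Suppose, in addition, that there exists a sequence $\{r_j\}_{j\ge1}$ of positive numbers with $r_j\to\infty$ as $j\to\infty$ such that $v_0(r_j)=0$ for all $j\ge1$, $\limsup_{j\to\infty}r_jv_0'(r_j)<\infty$, and $r_j^n\rho_0(r_j)\to0$ as $j\to\infty$. Then the solution of the radial Euler-Poisson system with initial data $(\rho_0,v_0)$ breaks down in finite time.
   Context: Function spaces: $D^0:=C([0,\infty))$, $D^1:=C([0,\infty))\cap C^1((0,\infty))$, $D^2:=C([0,\infty))\cap C^2((0,\infty))$. Radial Euler-Poisson system for $\rho(t,r),v(t,r),\Phi(t,r)$, $(t,r)\in\mathbb{R}_+\times\mathbb{R}_+$: $$r^{n-1}\rho_t+\partial_r(r^{n-1}\rho v)=0,\quad v_t+v\,\partial_rv+\lambda\,\partial_r\Phi=0,\quad\partial_r(r^{n-1}\partial_r\Phi)=r^{n-1}\rho,\quad(\rho,v)(0,r)=(\rho_0,v_0)(r).$$ Since $\rho_0$ is only in $D^0$, "classical solution" means that, with $m(t,r)=\int_0^r\rho(t,s)s^{n-1}ds$, the first equation is replaced by $\partial_tm+v\,\partial_rm=0$ and $(m,v,\Phi)$ solves the resulting system in the classical sense. The solution is global if a classical solution exists for all $t\ge0$; otherwise it breaks down in finite time. In terms of the characteristic curves $X(t,R)$, defined by $X''(t,R)=-\lambda m_0(R)X(t,R)^{-(n-1)}$,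 $X'(0,R)=v_0(R)$, $X(0,R)=R$ with $m_0(R)=\int_0^R\rho_0(s)s^{n-1}ds$, breakdown occurs when $X(t_c,R)=0$ or $\partial_RX(t_c,R)=0$ for some $R>0$ and some $t_c\in(0,\infty)$. *)

theory Defs
  imports "HOL-Analysis.Analysis"
begin

text \<open>
  Functions of \<open>r \<in> [0,\<infinity>)\<close> are total functions on the reals of which only the values on
  \<open>{0..}\<close> matter.
\<close>

definition D0 :: "(real \<Rightarrow> real) set" where
  "D0 = {f. continuous_on {0..} f}"

definition D1 :: "(real \<Rightarrow> real) set" where
  "D1 = {f. continuous_on {0..} f \<and> f C1_differentiable_on {0<..}}"

definition D2 :: "(real \<Rightarrow> real) set" where
  "D2 = {f. continuous_on {0..} f \<and> f C1_differentiable_on {0<..}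
            \<and> deriv f C1_differentiable_on {0<..}}"

text \<open>
  \<open>f\<close> is of class \<open>C\<^sup>1\<close> for \<open>t \<ge> 0\<close>, \<open>r > 0\<close>, with partial derivatives \<open>ft\<close> and \<open>fr\<close>;
  the time derivative at \<open>t = 0\<close> is one-sided.
\<close>

definition has_C1_partials ::
  "(real \<Rightarrow> real \<Rightarrow> real) \<Rightarrow> (real \<Rightarrow> real \<Rightarrow> real) \<Rightarrow> (real \<Rightarrow> real \<Rightarrow> real) \<Rightarrow> bool" where
  "has_C1_partials f ft fr \<longleftrightarrow>
     (\<forall>t\<ge>0. \<forall>r>0.
        ((\<lambda>\<tau>. f \<tau> r) has_real_derivative ft t r) (at t within {0..}) \<and>
        ((\<lambda>s. f t s) has_real_derivative fr t r) (at r)) \<and>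
     continuous_on ({0..} \<times> {0<..}) (\<lambda>(t, r). ft t r) \<and>
     continuous_on ({0..} \<times> {0<..}) (\<lambda>(t, r). fr t r)"

definition mass :: "nat \<Rightarrow> (real \<Rightarrow> real \<Rightarrow> real) \<Rightarrow> real \<Rightarrow> real \<Rightarrow> real" where
  "mass n \<rho> t r = integral {0..r} (\<lambda>s. \<rho> t s * s ^ (n - 1))"

text \<open>
  Classical solution on the whole time interval \<open>[0,\<infinity>)\<close>: the continuity equation is imposed in
  the form \<open>m\<^sub>t + v m\<^sub>r = 0\<close>, and \<open>(m, v, \<Phi>)\<close> satisfies the system pointwise for \<open>r > 0\<close>.

  No boundary behaviour of \<open>\<rho>\<close> and \<open>v\<close> at \<open>r = 0\<close> is imposed for \<open>t > 0\<close>, apart from the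
  integrability that makes \<open>m\<close> meaningful; the continuity of \<open>\<rho>(t,\<cdot>)\<close> on \<open>(0,\<infinity>)\<close> is a
  consequence of the Poisson equation and \<open>\<Phi>(t,\<cdot>) \<in> D2\<close>.  Asking for more at the origin would
  only make the class of solutions smaller, that is, breakdown easier.  The continuity of
  \<open>\<Phi>(t,\<cdot>)\<close> at \<open>0\<close>, on the other hand, is essential: it excludes the singular solutions
  \<open>r\<^sup>n\<^sup>-\<^sup>1 \<Phi>\<^sub>r = m + c(t)\<close>, \<open>c(t) \<noteq> 0\<close>, of the Poisson equation.
\<close>

definition global_classical_solution ::
  "nat \<Rightarrow> real \<Rightarrow> (real \<Rightarrow> real) \<Rightarrow> (real \<Rightarrow> real) \<Rightarrow>
   (real \<Rightarrow> real \<Rightarrow> real) \<Rightarrow> (real \<Rightarrow> real \<Rightarrow> real) \<Rightarrow> (real \<Rightarrow> real \<Rightarrow> real) \<Rightarrow> bool" where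
  "global_classical_solution n lam \<rho>0 v0 \<rho> v \<Phi> \<longleftrightarrow>
     (\<forall>t\<ge>0. \<forall>r>0. (\<lambda>s. \<rho> t s * s ^ (n - 1)) absolutely_integrable_on {0..r}) \<and>
     (\<forall>t\<ge>0. \<Phi> t \<in> D2) \<and>
     (\<exists>mt mr vt vr.
        has_C1_partials (mass n \<rho>) mt mr \<and>
        has_C1_partials v vt vr \<and>
        (\<forall>t\<ge>0. \<forall>r>0. mt t r + v t r * mr t r = 0) \<and>
        (\<forall>t\<ge>0. \<forall>r>0. vt t r + v t r * vr t r + lam * deriv (\<Phi> t) r = 0)) \<and>
     (\<forall>t\<ge>0. \<forall>r>0.
        ((\<lambda>s. s ^ (n - 1) * deriv (\<Phi> t) s) has_real_derivative r ^ (n - 1) * \<rho> t r) (at r)) \<and>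
     (\<forall>r\<ge>0. \<rho> 0 r = \<rho>0 r \<and> v 0 r = v0 r)"

definition breaks_down_in_finite_time ::
  "nat \<Rightarrow> real \<Rightarrow> (real \<Rightarrow> real) \<Rightarrow> (real \<Rightarrow> real) \<Rightarrow> bool" where
  "breaks_down_in_finite_time n lam \<rho>0 v0 \<longleftrightarrow>
     \<not> (\<exists>\<rho> v \<Phi>. global_classical_solution n lam \<rho>0 v0 \<rho> v \<Phi>)"

end

(* Along a characteristic the mass is conserved, so X'' = - lam * m0(R) / X^(n-1).  At a zero R of
   v0 the solution is R * xi(omega t), where xi'' = 1 / xi^(n-1), xi 0 = 1, xi' 0 = 0 and
   omega^2 = - lam * m0(R) / R^n.  Scaling and time translation produce the variation of X with
   respect to R explicitly: with tau = omega t,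
     Y = xi - (n/2) tau xi' + (R^n rho0(R) / (2 m0(R))) tau xi' + (v0'(R) / omega) xi'.
   In a global C^1 solution Y solves Y' = v_r(t, X) Y, Y(0) = 1, hence stays positive.  But
   xi - (n/2) tau xi' tends to minus infinity and, for R = r_j with j large, dominates the last
   two terms at a suitable tau, since the third coefficient tends to 0: for n >= 3 because xi' is
   bounded, for n = 2 because v0'(R) / omega is bounded above uniformly in j. *)
theory Submission
  imports Defs
begin

section \<open>The Poisson equation: no flux at the origin\<close>

text \<open>A flux that does not vanish at the origin would make \<open>\<phi>\<close> diverge there at least
  logarithmically, contradicting continuity at \<open>0\<close>.\<close>

lemma radial_poisson_flux:
  fixes \<phi> g :: "real \<Rightarrow> real"
  assumes \<phi>: "\<phi> \<in> D2" and p: "p \<ge> 1"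
    and ai: "\<And>r. r > 0 \<Longrightarrow> g integrable_on {0..r}"
    and D: "\<And>r. r > 0 \<Longrightarrow> ((\<lambda>s. s ^ p * deriv \<phi> s) has_real_derivative g r) (at r)"
    and r: "r > 0"
  shows "r ^ p * deriv \<phi> r = integral {0..r} g"
proof -
  define G where "G s = s ^ p * deriv \<phi> s" for s
  define c where "c = G r - integral {0..r} g"
  \<comment> \<open>The fundamental theorem on intervals \<open>{a..b}\<close> with
    \<open>0 < a\<close> shows that \<open>G\<close> and the integral from 0 differ by a constant;
    the claim becomes \<open>c = 0\<close>.\<close>
  have flux: "G s = integral {0..s} g + c" if s: "s > 0" for s
  proof -
    have *: "integral {0..b} g - integral {0..a} g = G b - G a" if ab: "0 < a" "a \<le> b" for a b
    proof -
      have "(g has_integral G b - G a) {a..b}"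
        using ab D
        by (intro fundamental_theorem_of_calculus)
          (auto simp: G_def has_real_derivative_iff_has_vector_derivative[symmetric]
            intro: has_field_derivative_at_within)
      moreover have "integral {0..a} g + integral {a..b} g = integral {0..b} g"
        using ab ai[of b] by (intro Henstock_Kurzweil_Integration.integral_combine) auto
      ultimately show ?thesis
        by (simp add: integral_unique)
    qed
    show ?thesis
      using *[of s r] *[of r s] s r by (cases "s \<le> r") (auto simp: c_def)
  qed
  have "c = 0"
  proof (rule ccontr)
    assume c: "c \<noteq> 0"
    \<comment> \<open>Dividing by \<open>c\<close> makes the slope positive near 0 whatever the sign
      of \<open>c\<close>.\<close>
    define \<psi> where "\<psi> s = \<phi> s / c" for s
    have d\<phi>: "(\<phi> has_real_derivative deriv \<phi> s) (at s)" if "s > 0" for s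
      using \<phi> that
      by (auto simp: D2_def C1_differentiable_on_eq DERIV_deriv_iff_real_differentiable)
    have "continuous_on {0..1} (\<lambda>s. integral {0..s} g)"
      using ai[of 1] by (intro indefinite_integral_continuous_1) auto
    then have "((\<lambda>s. integral {0..s} g) \<longlongrightarrow> integral {0..0} g) (at 0 within {0..1})"
      unfolding continuous_on_def by (rule bspec) simp
    then have "\<forall>\<^sub>F s in at 0 within {0..1}. \<bar>integral {0..s} g\<bar> < \<bar>c\<bar> / 2"
      using c by (auto simp: tendsto_iff dist_real_def dest!: spec[of _ "\<bar>c\<bar> / 2"])
    then obtain d where d: "d > 0"
      "\<And>s. 0 < s \<Longrightarrow> s \<le> 1 \<Longrightarrow> s < d \<Longrightarrow> \<bar>integral {0..s} g\<bar> < \<bar>c\<bar> / 2"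
      by (auto simp: eventually_at dist_real_def)
    define e where "e = min (d / 2) 1"
    have e: "0 < e" "e \<le> 1" "e < d"
      using d(1) by (auto simp: e_def)
    \<comment> \<open>Near 0 the integral is below half of \<open>c\<close> in absolute value, so
      the normalized flux is at least 1/2. Then \<open>s ^ p \<le> s\<close> on \<open>(0,1]\<close>
      gives a lower bound whose primitive is \<open>ln s / 2\<close>.\<close>
    have slope: "1 / (2 * s) \<le> deriv \<phi> s / c" if s: "0 < s" "s \<le> e" for s
    proof -
      have "\<bar>integral {0..s} g / c\<bar> \<le> 1 / 2"
        using d(2)[of s] s e c by (simp add: field_simps)
      then have "1 / 2 \<le> integral {0..s} g / c + 1"
        by linarith
      also have "\<dots> = (integral {0..s} g + c) / c"
        using c by (simp add: add_divide_distrib)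
      also have "\<dots> = s ^ p * (deriv \<phi> s / c)"
        using flux[of s] s by (simp add: G_def)
      finally have *: "1 / 2 \<le> s ^ p * (deriv \<phi> s / c)" .
      then have "deriv \<phi> s / c > 0"
        using s by (smt (verit) divide_pos_pos zero_less_mult_pos zero_less_power)
      moreover have "s ^ p \<le> s"
        using power_decreasing[of 1 p s] p s e by simp
      ultimately have "s ^ p * (deriv \<phi> s / c) \<le> s * (deriv \<phi> s / c)"
        by (intro mult_right_mono) auto
      with * have "1 / 2 \<le> s * (deriv \<phi> s / c)"
        by linarith
      then show ?thesis
        using s by (simp add: field_simps)
    qed
    have log: "\<psi> s - ln s / 2 \<le> \<psi> e - ln e / 2" if s: "0 < s" "s \<le> e" for s
    proof (rule DERIV_nonneg_imp_nondecreasing[OF s(2)])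
      fix x assume x: "s \<le> x" "x \<le> e"
      have "((\<lambda>s. \<psi> s - ln s / 2) has_real_derivative deriv \<phi> x / c - 1 / (2 * x)) (at x)"
        unfolding \<psi>_def using s x c
        by (auto intro!: derivative_eq_intros d\<phi>)
      then show "\<exists>y. ((\<lambda>s. \<psi> s - ln s / 2) has_real_derivative y) (at x) \<and> 0 \<le> y"
        using slope[of x] s x by auto
    qed
    have "continuous_on {0..e} \<psi>"
      using \<phi> unfolding \<psi>_def D2_def
      by (auto intro!: continuous_on_divide continuous_on_const intro: continuous_on_subset simp: c)
    then have "bounded (\<psi> ` {0..e})"
      by (intro compact_imp_bounded compact_continuous_image) auto
    then obtain B where B: "\<And>s. s \<in> {0..e} \<Longrightarrow> \<bar>\<psi> s\<bar> \<le> B"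
      by (fastforce simp: bounded_iff)
    \<comment> \<open>The bound \<open>B\<close> and the estimate \<open>log\<close> together force
      \<open>l \<ge> ln e - 4 * B\<close>; the extra 2 violates this strictly, and the minimum with
      \<open>ln e\<close> keeps \<open>exp l\<close> inside \<open>{0..e}\<close>.\<close>
    define l where "l = min (ln e) (ln e - 4 * B - 2)"
    have l: "0 < exp l" "exp l \<le> e"
      using e(1) by (auto simp: l_def ln_ge_iff[symmetric])
    have "- B \<le> \<psi> (exp l)" "\<psi> e \<le> B"
      using B[of "exp l"] B[of e] l e(1) by (auto simp: abs_le_iff)
    moreover have "\<psi> (exp l) - l / 2 \<le> \<psi> e - ln e / 2"
      using log[OF l] by simp
    moreover have "l \<le> ln e - 4 * B - 2"
      by (simp add: l_def)
    ultimately show False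
      by linarith
  qed
  then show ?thesis
    using flux[OF r] by (simp add: G_def)
qed

section \<open>Explicit unit profiles of the characteristic equation\<close>

text \<open>The parameter \<open>s\<close> is chosen so that the energy identity for \<open>\<xi>'' = 1 / \<xi>\<^sup>p\<close> has a closed form:
  \<open>s = \<xi>'\<close> for \<open>p = 1\<close>, and \<open>cosh s = \<xi> powr k\<close> with \<open>k = (p - 1) / 2\<close> for \<open>p \<ge> 2\<close>.\<close>

lemma unit_profile_from_parametrization:
  fixes \<eta> \<nu> P :: "real \<Rightarrow> real"
  assumes P: "continuous_on UNIV P" and \<delta>: "0 < \<delta>" "\<And>s. \<delta> \<le> P s"
    and \<eta>: "\<And>s. (\<eta> has_real_derivative \<nu> s * P s) (at s)"
    and \<nu>: "\<And>s. (\<nu> has_real_derivative P s / \<eta> s ^ p) (at s)"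
  obtains \<xi> u T where
    "\<And>t. (\<xi> has_real_derivative u t) (at t)"
    "\<And>t. (u has_real_derivative 1 / \<xi> t ^ p) (at t)"
    "\<And>s. (T has_real_derivative P s) (at s)" "T 0 = 0" "surj T"
    "\<And>s. \<xi> (T s) = \<eta> s" "\<And>s. u (T s) = \<nu> s"
proof -
  \<comment> \<open>The interval integral is signed, so \<open>T\<close> also covers negative times;
    these occur later when the time shift \<open>\<kappa> * h\<close> is negative.\<close>
  define T where "T s = (LBINT w=0..s. P w)" for s :: real
  have T: "(T has_real_derivative P s) (at s)" for s
  proof -
    have "(T has_vector_derivative P s) (at s within {- \<bar>s\<bar> - 1..\<bar>s\<bar> + 1})"
      unfolding T_def zero_ereal_def
      by (rule interval_integral_FTC2) (auto intro: continuous_on_subset[OF P])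
    then show ?thesis
      by (subst (asm) at_within_Icc_at) (auto simp: has_real_derivative_iff_has_vector_derivative)
  qed
  have T0: "T 0 = 0"
    by (simp add: T_def zero_ereal_def)
  \<comment> \<open>The lower bound \<open>\<delta>\<close> on the derivative makes \<open>T\<close>
    expand distances, which yields surjectivity by the intermediate value theorem as well as
    injectivity.\<close>
  have expand: "\<delta> * (b - a) \<le> T b - T a" if "a \<le> b" for a b
  proof -
    have "T a - \<delta> * a \<le> T b - \<delta> * b"
    proof (rule DERIV_nonneg_imp_nondecreasing[OF that])
      fix x
      have "((\<lambda>s. T s - \<delta> * s) has_real_derivative P x - \<delta>) (at x)"
        by (auto intro!: derivative_eq_intros T)
      then show "\<exists>y. ((\<lambda>s. T s - \<delta> * s) has_real_derivative y) (at x) \<and> 0 \<le> y"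
        using \<delta>(2)[of x] by auto
    qed
    then show ?thesis by (simp add: algebra_simps)
  qed
  have contT: "isCont T s" for s
    using T DERIV_isCont by blast
  have surj: "\<exists>s. T s = t" for t
  proof -
    have "T (- (\<bar>t\<bar> / \<delta>)) \<le> t" "t \<le> T (\<bar>t\<bar> / \<delta>)"
      using expand[of "- (\<bar>t\<bar> / \<delta>)" 0] expand[of 0 "\<bar>t\<bar> / \<delta>"] \<delta>(1) T0 by auto
    moreover have "- (\<bar>t\<bar> / \<delta>) \<le> \<bar>t\<bar> / \<delta>"
      using \<delta>(1) by simp
    ultimately show ?thesis
      using IVT'[of T "- (\<bar>t\<bar> / \<delta>)" t "\<bar>t\<bar> / \<delta>"] contT
      by (auto intro: continuous_at_imp_continuous_on)
  qed
  have inj: "a = b" if "T a = T b" for a b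
  proof -
    have "\<not> a < b" if "T a = T b" for a b
      using expand[of a b] mult_pos_pos[of \<delta> "b - a"] that \<delta>(1) by linarith
    then show ?thesis
      using that by (metis linorder_neqE_linordered_idom)
  qed
  \<comment> \<open>Passing to the inverse of \<open>T\<close> cancels the factor \<open>P\<close>
    in both derivatives and leaves the autonomous system for the position and its velocity.\<close>
  define \<sigma> where "\<sigma> = inv T"
  have \<sigma>T: "\<sigma> (T s) = s" for s
    unfolding \<sigma>_def by (rule inv_f_f) (auto intro: injI inj)
  have T\<sigma>: "T (\<sigma> t) = t" for t
    using surj \<sigma>T by metis
  have \<sigma>: "(\<sigma> has_real_derivative inverse (P (\<sigma> t))) (at t)" for t
  proof (rule has_field_derivative_inverse_basic[OF T _ _ open_UNIV])
    have "isCont \<sigma> (T (\<sigma> t))"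
      by (rule isCont_inverse_function[of 1]) (auto simp: \<sigma>T contT)
    then show "continuous (at t) \<sigma>"
      by (simp add: T\<sigma>)
    show "P (\<sigma> t) \<noteq> 0"
      using \<delta>(1) \<delta>(2)[of "\<sigma> t"] by linarith
  qed (auto simp: T\<sigma>)
  have Ppos: "P s \<noteq> 0" for s
    using \<delta>(1) \<delta>(2)[of s] by linarith
  show ?thesis
  proof
    show "((\<lambda>t. \<eta> (\<sigma> t)) has_real_derivative \<nu> (\<sigma> t)) (at t)" for t
      using DERIV_chain2[OF \<eta> \<sigma>, of t] Ppos by (simp add: mult.assoc)
    show "((\<lambda>t. \<nu> (\<sigma> t)) has_real_derivative 1 / \<eta> (\<sigma> t) ^ p) (at t)" for t
      using DERIV_chain2[OF \<nu> \<sigma>, of t] Ppos by (simp add: field_simps)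
    show "surj T"
      using surj by (metis surj_def)
  qed (auto simp: T T0 \<sigma>T)
qed

text \<open>The energy identity here is \<open>u^2 / 2 = ln \<xi>\<close>, so \<open>u = s\<close>
  gives \<open>\<xi> = exp (s^2 / 2)\<close>. The velocity is unbounded, yet \<open>t * u\<close>
  outgrows \<open>\<xi>\<close> by a margin quadratic in \<open>u\<close>, which beats any linear
  term \<open>C * u\<close>.\<close>

lemma unit_profile_2:
  obtains \<xi> u :: "real \<Rightarrow> real" where
    "\<And>t. (\<xi> has_real_derivative u t) (at t)"
    "\<And>t. (u has_real_derivative 1 / \<xi> t) (at t)"
    "\<xi> 0 = 1" "u 0 = 0" "\<And>t. \<xi> t > 0"
    "\<And>C. \<exists>t\<ge>0. u t \<ge> 0 \<and> \<xi> t - t * u t + C * u t < 0"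
proof -
  have exp_ge: "1 \<le> exp (s\<^sup>2 / 2)" for s :: real
    by simp
  obtain \<xi> u T where p:
    "\<And>t. (\<xi> has_real_derivative u t) (at t)"
    "\<And>t. (u has_real_derivative 1 / \<xi> t ^ 1) (at t)"
    "\<And>s. (T has_real_derivative exp (s\<^sup>2 / 2)) (at s)" "T 0 = 0" "surj T"
    "\<And>s. \<xi> (T s) = exp (s\<^sup>2 / 2)" "\<And>s. u (T s) = s"
    by (rule unit_profile_from_parametrization[where \<eta> = "\<lambda>s. exp (s\<^sup>2 / 2)" and \<nu> = "\<lambda>s. s"
          and P = "\<lambda>s. exp (s\<^sup>2 / 2)" and \<delta> = 1 and p = 1])
      (auto intro!: continuous_intros derivative_eq_intros)
  have T_ge: "s \<le> T s" if s: "0 \<le> s" for s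
  proof -
    have "T 0 - 0 \<le> T s - s"
    proof (rule DERIV_nonneg_imp_nondecreasing[OF s])
      fix x
      have "((\<lambda>s. T s - s) has_real_derivative exp (x\<^sup>2 / 2) - 1) (at x)"
        by (auto intro!: derivative_eq_intros p(3))
      then show "\<exists>y. ((\<lambda>s. T s - s) has_real_derivative y) (at x) \<and> 0 \<le> y"
        using exp_ge[of x] by (meson diff_ge_0_iff_ge)
    qed
    then show ?thesis
      using p(4) by simp
  qed
  \<comment> \<open>Differentiating the first two terms, both contributions
    \<open>s * exp (s^2 / 2)\<close> cancel and only \<open>- T s\<close> remains, which is at most
    \<open>- s\<close>.\<close>
  have turn: "exp (s\<^sup>2 / 2) - T s * s \<le> 1 - s\<^sup>2 / 2" if s: "0 \<le> s" for s
  proof -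
    have "exp (s\<^sup>2 / 2) - T s * s + s\<^sup>2 / 2 \<le> exp (0\<^sup>2 / 2) - T 0 * 0 + 0\<^sup>2 / 2"
    proof (rule DERIV_nonpos_imp_nonincreasing[OF s])
      fix x :: real assume x: "0 \<le> x"
      have "((\<lambda>s. exp (s\<^sup>2 / 2) - T s * s + s\<^sup>2 / 2) has_real_derivative x - T x) (at x)"
        by (auto intro!: derivative_eq_intros p(3))
      then show "\<exists>y. ((\<lambda>s. exp (s\<^sup>2 / 2) - T s * s + s\<^sup>2 / 2) has_real_derivative y) (at x) \<and> y \<le> 0"
        using T_ge[OF x] by (meson diff_le_0_iff_le)
    qed
    then show ?thesis by simp
  qed
  show ?thesis
  proof
    show "\<exists>t\<ge>0. u t \<ge> 0 \<and> \<xi> t - t * u t + C * u t < 0" for C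
    proof (intro exI conjI)
      \<comment> \<open>This choice makes \<open>s^2 / 2\<close> equal to
        \<open>\<bar>C\<bar> * s + s\<close>, so the bound from \<open>turn\<close> drops to
        \<open>1 - s\<close>, and \<open>s \<ge> 2\<close>.\<close>
      define s where "s = 2 * \<bar>C\<bar> + 2"
      have s: "0 \<le> s" by (simp add: s_def)
      show "0 \<le> T s" using T_ge[OF s] s by linarith
      show "0 \<le> u (T s)" using s by (simp add: p)
      have "C * s \<le> \<bar>C\<bar> * s"
        using s by (intro mult_right_mono) auto
      moreover have "s\<^sup>2 / 2 = \<bar>C\<bar> * s + s"
        by (simp add: s_def power2_eq_square algebra_simps)
      ultimately have "1 - s\<^sup>2 / 2 + C * s \<le> 1 - s"
        by linarith
      then have "1 - s\<^sup>2 / 2 + C * s < 0"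
        by (simp add: s_def)
      then show "\<xi> (T s) - T s * u (T s) + C * u (T s) < 0"
        using turn[OF s] by (simp add: p)
    qed
    show "\<xi> t > 0" for t
      using p(6) p(5) by (metis exp_gt_zero surj_def)
    show "\<xi> 0 = 1" "u 0 = 0"
      using p(4) p(6)[of 0] p(7)[of 0] by simp_all
  qed (use p(1,2) in auto)
qed

text \<open>The velocity increases to a finite limit \<open>c\<close>, so \<open>\<xi>\<close> and
  \<open>t * u\<close> both grow like \<open>c * t\<close> while \<open>C * u\<close> stays bounded.
  Any coefficient above 1 would do; 5/4 is what remains of \<open>n / 2 \<ge> 3 / 2\<close> after
  1/4 is given up to the density term.\<close>

lemma unit_profile_ge_3:
  fixes n :: nat
  assumes n: "n \<ge> 3"
  obtains \<xi> u :: "real \<Rightarrow> real" where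
    "\<And>t. (\<xi> has_real_derivative u t) (at t)"
    "\<And>t. (u has_real_derivative 1 / \<xi> t ^ (n - 1)) (at t)"
    "\<xi> 0 = 1" "u 0 = 0" "\<And>t. \<xi> t > 0"
    "\<And>C. \<exists>t\<ge>0. u t \<ge> 0 \<and> \<xi> t - 5 / 4 * t * u t + C * u t < 0"
proof -
  \<comment> \<open>The energy identity reads
    \<open>u^2 = (1 / k) * (1 - \<xi> powr (- 2 * k))\<close>. Hence \<open>c\<close> is the
    limiting speed, and \<open>cosh s = \<xi> powr k\<close> turns \<open>u\<close> into
    \<open>c * tanh s\<close>.\<close>
  define k where "k = (real n - 2) / 2"
  define c where "c = 1 / sqrt k"
  have k: "k > 0" using n by (simp add: k_def)
  have c: "c > 0" "c * c = 1 / k"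
    using k by (auto simp: c_def)
  define \<eta> where "\<eta> s = cosh s powr (1 / k)" for s :: real
  have \<eta>_ge: "1 \<le> \<eta> s" for s
    unfolding \<eta>_def using k cosh_real_ge_1[of s] by (intro ge_one_powr_ge_zero) auto
  have \<eta>_pow: "\<eta> s ^ (n - 1) = \<eta> s * (cosh s)\<^sup>2" for s
  proof -
    have "\<eta> s ^ (n - 1) = cosh s powr (1 / k * real (n - 1))"
      using cosh_real_pos[of s] by (simp add: \<eta>_def powr_powr flip: powr_realpow)
    also have "1 / k * real (n - 1) = 1 / k + 2"
      using k n by (simp add: k_def field_simps of_nat_diff)
    finally show ?thesis
      using cosh_real_pos[of s] by (simp add: \<eta>_def powr_add)
  qed
  have D\<eta>: "(\<eta> has_real_derivative c * tanh s * (c * \<eta> s)) (at s)" for s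
  proof -
    have "(\<eta> has_real_derivative 1 / k * cosh s powr (1 / k - 1) * sinh s) (at s)"
      unfolding \<eta>_def using cosh_real_pos[of s]
      by (auto intro!: derivative_eq_intros simp: powr_diff field_simps)
    moreover have "1 / k * cosh s powr (1 / k - 1) * sinh s = (c * c) * \<eta> s * tanh s"
      using cosh_real_pos[of s] by (simp add: c(2) \<eta>_def tanh_def powr_diff)
    ultimately show ?thesis
      by (simp add: mult_ac)
  qed
  have D\<nu>: "((\<lambda>s. c * tanh s) has_real_derivative (c * \<eta> s) / \<eta> s ^ (n - 1)) (at s)" for s
  proof -
    have "(c * \<eta> s) / \<eta> s ^ (n - 1) = c * (1 - (tanh s)\<^sup>2)"
    proof -
      have "1 - (tanh s)\<^sup>2 = 1 / (cosh s)\<^sup>2"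
        using cosh_real_pos[of s] sinh_square_eq[of s]
        by (simp add: tanh_def power_divide diff_divide_distrib)
      then show ?thesis
        unfolding \<eta>_pow using \<eta>_ge[of s] by simp
    qed
    then show ?thesis
      using cosh_real_pos[of s] by (auto intro!: derivative_eq_intros)
  qed
  obtain \<xi> u T where p:
    "\<And>t. (\<xi> has_real_derivative u t) (at t)"
    "\<And>t. (u has_real_derivative 1 / \<xi> t ^ (n - 1)) (at t)"
    "\<And>s. (T has_real_derivative c * \<eta> s) (at s)" "T 0 = 0" "surj T"
    "\<And>s. \<xi> (T s) = \<eta> s" "\<And>s. u (T s) = c * tanh s"
  proof (rule unit_profile_from_parametrization[where \<eta> = \<eta> and \<nu> = "\<lambda>s. c * tanh s"
          and P = "\<lambda>s. c * \<eta> s" and \<delta> = c and p = "n - 1"])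
    show "continuous_on UNIV (\<lambda>s. c * \<eta> s)"
      using D\<eta> by (intro continuous_intros) (meson DERIV_isCont continuous_at_imp_continuous_on)
    show "c \<le> c * \<eta> s" for s
      using \<eta>_ge[of s] c by simp
  qed (use D\<eta> D\<nu> c in auto)
  have T_ge: "c * s \<le> T s" if s: "0 \<le> s" for s
  proof -
    have "T 0 - c * 0 \<le> T s - c * s"
    proof (rule DERIV_nonneg_imp_nondecreasing[OF s])
      fix x
      have "((\<lambda>s. T s - c * s) has_real_derivative c * \<eta> x - c) (at x)"
        by (auto intro!: derivative_eq_intros p(3))
      moreover have "c * \<eta> x - c \<ge> 0"
        using \<eta>_ge[of x] c by simp
      ultimately show "\<exists>y. ((\<lambda>s. T s - c * s) has_real_derivative y) (at x) \<and> 0 \<le> y"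
        by blast
    qed
    then show ?thesis
      using p(4) by simp
  qed
  have \<eta>_le: "\<eta> s \<le> 1 + c * T s" if s: "0 \<le> s" for s
  proof -
    have "\<eta> s - c * T s \<le> \<eta> 0 - c * T 0"
    proof (rule DERIV_nonpos_imp_nonincreasing[OF s])
      fix x
      have "((\<lambda>s. \<eta> s - c * T s) has_real_derivative c * tanh x * (c * \<eta> x) - c * (c * \<eta> x)) (at x)"
        by (auto intro!: derivative_eq_intros p(3) D\<eta>)
      moreover have "c * tanh x * (c * \<eta> x) \<le> c * (c * \<eta> x)"
        using c \<eta>_ge[of x] tanh_real_lt_1[of x] by (intro mult_right_mono) auto
      ultimately show "\<exists>y. ((\<lambda>s. \<eta> s - c * T s) has_real_derivative y) (at x) \<and> y \<le> 0"
        by (meson diff_le_0_iff_le)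
    qed
    then show ?thesis
      using p(4) by (simp add: \<eta>_def)
  qed
  show ?thesis
  proof
    show "\<exists>t\<ge>0. u t \<ge> 0 \<and> \<xi> t - 5 / 4 * t * u t + C * u t < 0" for C
    proof (intro exI conjI)
      define Q where "Q = \<bar>C\<bar> * c"
      \<comment> \<open>The summand 9 gives \<open>exp (2 * s) \<ge> 19\<close>, hence
        \<open>tanh s \<ge> 9 / 10\<close>; the other summand makes \<open>c * (c * s)\<close>
        exceed \<open>9 * (1 + Q)\<close>, where \<open>Q\<close> bounds the term with
        \<open>C\<close>.\<close>
      define s where "s = 9 + 9 * (1 + Q) / (c * c)"
      have Q: "0 \<le> Q" using c(1) by (simp add: Q_def)
      have s: "9 \<le> s" using c(1) Q by (simp add: s_def)
      have big: "c * (c * s) > 9 * (1 + Q)"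
        using c(1) by (simp add: s_def field_simps)
      have T0: "0 \<le> c * s" "c * s \<le> T s"
        using T_ge[of s] s c(1) by simp_all
      have th: "9 / 10 \<le> tanh s" "tanh s \<le> 1"
      proof -
        have "19 \<le> exp (2 * s)"
          using exp_ge_add_one_self[of "2 * s"] s by linarith
        then have "exp (- (2 * s)) \<le> 1 / 19"
          by (simp add: exp_minus field_simps)
        moreover have "1 + exp (- (2 * s)) > 0"
          by (intro add_pos_pos) auto
        ultimately show "9 / 10 \<le> tanh s"
          by (simp add: tanh_real_altdef pos_le_divide_eq)
        show "tanh s \<le> 1"
          using tanh_real_lt_1[of s] by simp
      qed
      show "0 \<le> T s" using T0 by linarith
      have ct: "0 \<le> c * tanh s" "c * tanh s \<le> c * 1"
        using c(1) th by (intro mult_nonneg_nonneg mult_left_mono; linarith)+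
      then show "0 \<le> u (T s)" by (simp only: p)
      define F where "F = T s * (c * tanh s)"
      have "C * (c * tanh s) \<le> Q"
        using order_trans[OF mult_right_mono[OF abs_ge_self ct(1)] mult_left_mono[OF ct(2) abs_ge_zero]]
        by (simp add: Q_def)
      moreover have "9 / 10 * (c * T s) \<le> F"
        using mult_right_mono[OF th(1), of "c * T s"] c(1) T0 by (simp add: F_def mult_ac)
      moreover have "c * (c * s) \<le> c * T s"
        using T0 c(1) by (intro mult_left_mono) auto
      moreover have "\<eta> s \<le> 1 + c * T s"
        using \<eta>_le s by simp
      \<comment> \<open>Since 5/4 times 9/10 is 9/8, the left side is at most
        \<open>1 + Q - A / 8\<close>, negative because \<open>A > 9 * (1 + Q)\<close>.\<close>
      moreover have "e - 5 / 4 * f + g < 0"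
        if "g \<le> Q" "9 / 10 * A \<le> f" "B \<le> A" "e \<le> 1 + A" "9 * (1 + Q) < B" for A B e f g :: real
        using that Q by argo
      ultimately have "\<eta> s - 5 / 4 * F + C * (c * tanh s) < 0"
        using big by blast
      then show "\<xi> (T s) - 5 / 4 * T s * u (T s) + C * u (T s) < 0"
        by (simp add: p F_def)
    qed
    show "\<xi> t > 0" for t
      using p(6) p(5) \<eta>_ge by (metis less_le_trans surj_def zero_less_one)
    show "\<xi> 0 = 1" "u 0 = 0"
      using p(4) p(6)[of 0] p(7)[of 0] by (simp_all add: \<eta>_def)
  qed (use p(1,2) in auto)
qed

section \<open>Calculus along curves and stability of trajectories\<close>

text \<open>Continuity of the radial partial upgrades the two partials to a total derivative
  relative to \<open>{0..} \<times> {0<..}\<close>, one-sided in time at \<open>t = 0\<close>; the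
  ordinary chain rule then applies along \<open>s \<mapsto> (s, x s)\<close>.\<close>

lemma has_C1_partials_chain:
  assumes C1: "has_C1_partials f ft fr" and t: "t \<in> S" and S: "S \<subseteq> {0..}"
    and x: "(x has_real_derivative x') (at t within S)"
    and pos: "\<And>s. s \<in> S \<Longrightarrow> x s > 0"
  shows "((\<lambda>s. f s (x s)) has_real_derivative ft t (x t) + fr t (x t) * x') (at t within S)"
proof -
  have t0: "t \<ge> 0" and xt: "x t > 0"
    using t S pos by auto
  have "((\<lambda>(s, y). f s y) has_derivative
      (\<lambda>(ds, dy). ft t (x t) * ds + blinfun_apply (blinfun_scaleR_left (fr t (x t))) dy))
      (at (t, x t) within {0..} \<times> {0<..})"
  proof (rule has_derivative_partialsI[where fy = "\<lambda>s y. blinfun_scaleR_left (fr s y)"])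
    show "((\<lambda>s. f s (x t)) has_derivative (*) (ft t (x t))) (at t within {0..})"
      using C1 t0 xt by (auto simp: has_C1_partials_def has_field_derivative_def)
    show "((\<lambda>y. f s y) has_derivative blinfun_apply (blinfun_scaleR_left (fr s y)))
        (at y within {0<..})" if "s \<in> {0..}" "y \<in> {0<..}" for s y
    proof -
      have "((\<lambda>y. f s y) has_derivative (*) (fr s y)) (at y)"
        using C1 that by (auto simp: has_C1_partials_def has_field_derivative_def)
      moreover have "(*) (fr s y) = blinfun_apply (blinfun_scaleR_left (fr s y))"
        by (auto simp: fun_eq_iff)
      ultimately show ?thesis
        by (metis has_derivative_at_withinI)
    qed
    have "((\<lambda>(s, y). fr s y) \<longlongrightarrow> fr t (x t)) (at (t, x t) within {0..} \<times> {0<..})"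
      using C1 t0 xt unfolding has_C1_partials_def continuous_on_def by fastforce
    then have "((\<lambda>z. blinfun_scaleR_left ((\<lambda>(s, y). fr s y) z)) \<longlongrightarrow> blinfun_scaleR_left (fr t (x t)))
        (at (t, x t) within {0..} \<times> {0<..})"
      by (rule bounded_linear.tendsto[OF bounded_linear_blinfun_scaleR_left])
    then show "continuous (at (t, x t) within {0..} \<times> {0<..}) (\<lambda>(s, y). blinfun_scaleR_left (fr s y))"
      by (simp add: continuous_within case_prod_unfold)
  qed (use xt in auto)
  then have D: "((\<lambda>(s, y). f s y) has_derivative (\<lambda>(ds, dy). ft t (x t) * ds + fr t (x t) * dy))
      (at (t, x t) within {0..} \<times> {0<..})"
    by (simp add: case_prod_unfold mult.commute)
  have "((\<lambda>s. (s, x s)) has_derivative (\<lambda>ds. (ds, x' * ds))) (at t within S)"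
    using x by (auto simp: has_field_derivative_def intro!: derivative_eq_intros)
  moreover have "(\<lambda>s. (s, x s)) ` S \<subseteq> {0..} \<times> {0<..}"
    using S pos by auto
  ultimately have "((\<lambda>(s, y). f s y) \<circ> (\<lambda>s. (s, x s)) has_derivative
      (\<lambda>(ds, dy). ft t (x t) * ds + fr t (x t) * dy) \<circ> (\<lambda>ds. (ds, x' * ds))) (at t within S)"
    by (intro diff_chain_within) (auto intro: has_derivative_subset[OF D])
  moreover have "(\<lambda>(ds, dy). ft t (x t) * ds + fr t (x t) * dy) \<circ> (\<lambda>ds. (ds, x' * ds))
      = (*) (ft t (x t) + fr t (x t) * x')"
    by (auto simp: fun_eq_iff algebra_simps)
  ultimately show ?thesis
    by (simp add: has_field_derivative_def o_def)
qed

lemma gronwall_le: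
  fixes E E' :: "real \<Rightarrow> real"
  assumes T: "0 \<le> T"
    and D: "\<And>t. t \<in> {0..T} \<Longrightarrow> (E has_real_derivative E' t) (at t within {0..T})"
    and le: "\<And>t. t \<in> {0..T} \<Longrightarrow> E' t \<le> K * E t"
  shows "E T \<le> E 0 * exp (K * T)"
proof -
  let ?F = "\<lambda>t. E t * exp (- K * t)"
  have "?F T \<le> ?F 0"
  proof (rule DERIV_nonpos_imp_decreasing_open[OF T])
    fix t assume t: "0 < t" "t < T"
    have "(E has_real_derivative E' t) (at t)"
      using D[of t] t by (simp add: at_within_Icc_at)
    then have "(?F has_real_derivative (E' t - K * E t) * exp (- K * t)) (at t)"
      by (auto intro!: derivative_eq_intros simp: algebra_simps)
    moreover have "(E' t - K * E t) * exp (- K * t) \<le> 0"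
      using le[of t] t by (simp add: mult_nonpos_nonneg)
    ultimately show "\<exists>y. (?F has_real_derivative y) (at t) \<and> y \<le> 0"
      by blast
  next
    have "continuous_on {0..T} E"
      using D by (metis DERIV_continuous continuous_on_eq_continuous_within)
    then show "continuous_on {0..T} ?F"
      by (intro continuous_intros)
  qed
  then show ?thesis
    by (simp add: exp_minus field_simps)
qed

text \<open>The curve \<open>x\<close> is only assumed to solve the second-order equation with frozen mass \<open>\<mu>\<close>; the
  velocity and mass defects along it satisfy a homogeneous linear system, so no existence theorem
  for characteristics of \<open>v\<close> is needed.\<close>

lemma trajectory_deviation:
  fixes a \<mu> T K :: real
  assumes C1m: "has_C1_partials m mt mr" and C1v: "has_C1_partials v vt vr"
    and meq: "\<And>t r. t \<ge> 0 \<Longrightarrow> r > 0 \<Longrightarrow> mt t r + v t r * mr t r = 0"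
    and veq: "\<And>t r. t \<ge> 0 \<Longrightarrow> r > 0 \<Longrightarrow> vt t r + v t r * vr t r = a * m t r / r ^ p"
    and T: "0 \<le> T" and a: "0 \<le> a"
    and x: "\<And>t. t \<in> {0..T} \<Longrightarrow> (x has_real_derivative y t) (at t within {0..T})"
    and y: "\<And>t. t \<in> {0..T} \<Longrightarrow> (y has_real_derivative a * \<mu> / x t ^ p) (at t within {0..T})"
    and pos: "\<And>t. t \<in> {0..T} \<Longrightarrow> x t > 0"
    and K: "\<And>t. t \<in> {0..T} \<Longrightarrow> 2 * \<bar>vr t (x t)\<bar> + \<bar>mr t (x t)\<bar> + a / x t ^ p \<le> K"
  shows "(v T (x T) - y T)\<^sup>2 \<le> ((v 0 (x 0) - y 0)\<^sup>2 + (m 0 (x 0) - \<mu>)\<^sup>2) * exp (K * T)"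
proof -
  define z where "z t = v t (x t) - y t" for t
  define q where "q t = m t (x t) - \<mu>" for t
  \<comment> \<open>In the chain rule the curve speed \<open>y\<close> is rewritten as
    \<open>v - z\<close>. The equation for \<open>v\<close> then removes everything except terms
    linear in \<open>z\<close> and \<open>q\<close>; the mass defect \<open>q\<close> is treated
    likewise.\<close>
  have z: "(z has_real_derivative - vr t (x t) * z t + a * q t / x t ^ p) (at t within {0..T})"
    if t: "t \<in> {0..T}" for t
  proof -
    have "(z has_real_derivative vt t (x t) + vr t (x t) * y t - a * \<mu> / x t ^ p)
        (at t within {0..T})"
      unfolding z_def
      by (intro DERIV_diff has_C1_partials_chain[OF C1v t _ x[OF t] pos] y[OF t]) auto
    moreover have "vt t (x t) + vr t (x t) * y t - a * \<mu> / x t ^ p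
        = - vr t (x t) * z t + a * q t / x t ^ p"
      using veq[of t "x t"] t pos[OF t] by (simp add: z_def q_def field_simps)
    ultimately show ?thesis by simp
  qed
  have q: "(q has_real_derivative - mr t (x t) * z t) (at t within {0..T})"
    if t: "t \<in> {0..T}" for t
  proof -
    have "(q has_real_derivative mt t (x t) + mr t (x t) * y t) (at t within {0..T})"
      unfolding q_def
      using DERIV_diff[OF has_C1_partials_chain[OF C1m t _ x[OF t] pos] DERIV_const] by auto
    moreover have "mt t (x t) + mr t (x t) * y t = - mr t (x t) * z t"
      using meq[of t "x t"] t pos[OF t] by (simp add: z_def algebra_simps)
    ultimately show ?thesis by simp
  qed
  \<comment> \<open>For this quadratic energy \<open>2 * \<bar>z * q\<bar> \<le> E\<close> absorbs
    the coupling terms, which explains the form of the bound \<open>K\<close>.\<close>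
  define E where "E t = (z t)\<^sup>2 + (q t)\<^sup>2" for t
  have "E T \<le> E 0 * exp (K * T)"
  proof (rule gronwall_le[OF T])
    fix t assume t: "t \<in> {0..T}"
    let ?E' = "2 * z t * (- vr t (x t) * z t + a * q t / x t ^ p) + 2 * q t * (- mr t (x t) * z t)"
    show "(E has_real_derivative ?E') (at t within {0..T})"
      unfolding E_def by (auto intro!: derivative_eq_intros z[OF t] q[OF t])
    define b where "b = a / x t ^ p"
    have b: "b \<ge> 0"
      using a pos[OF t] by (simp add: b_def)
    have zq: "2 * \<bar>z t * q t\<bar> \<le> E t"
      using sum_squares_bound[of "\<bar>z t\<bar>" "\<bar>q t\<bar>"] by (simp add: E_def abs_mult)
    have "?E' = - 2 * vr t (x t) * (z t)\<^sup>2 + b * (2 * (z t * q t)) - mr t (x t) * (2 * (z t * q t))"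
      by (simp add: b_def power2_eq_square algebra_simps)
    also have "\<dots> \<le> 2 * \<bar>vr t (x t)\<bar> * E t + b * E t + \<bar>mr t (x t)\<bar> * E t"
    proof -
      have "- 2 * vr t (x t) * (z t)\<^sup>2 \<le> 2 * \<bar>vr t (x t)\<bar> * E t"
      proof -
        have "- 2 * vr t (x t) * (z t)\<^sup>2 \<le> 2 * \<bar>vr t (x t)\<bar> * (z t)\<^sup>2"
          by (intro mult_right_mono) auto
        also have "\<dots> \<le> 2 * \<bar>vr t (x t)\<bar> * E t"
          by (intro mult_left_mono) (auto simp: E_def)
        finally show ?thesis .
      qed
      moreover have "b * (2 * (z t * q t)) \<le> b * E t"
        using b zq by (intro mult_left_mono) auto
      moreover have "- mr t (x t) * (2 * (z t * q t)) \<le> \<bar>mr t (x t)\<bar> * E t"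
      proof -
        have "- mr t (x t) * (2 * (z t * q t)) \<le> \<bar>mr t (x t)\<bar> * (2 * \<bar>z t * q t\<bar>)"
        proof -
          have "- (mr t (x t) * (z t * q t)) \<le> \<bar>mr t (x t)\<bar> * \<bar>z t * q t\<bar>"
            by (metis abs_ge_minus_self abs_mult)
          then show ?thesis by linarith
        qed
        also have "\<dots> \<le> \<bar>mr t (x t)\<bar> * E t"
          using zq by (intro mult_left_mono) auto
        finally show ?thesis .
      qed
      ultimately show ?thesis by linarith
    qed
    also have "\<dots> = (2 * \<bar>vr t (x t)\<bar> + \<bar>mr t (x t)\<bar> + b) * E t"
      by (simp add: algebra_simps)
    also have "\<dots> \<le> K * E t"
      using K[OF t] by (intro mult_right_mono) (auto simp: b_def E_def)
    finally show "?E' \<le> K * E t" .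
  qed
  then have "(z T)\<^sup>2 \<le> E 0 * exp (K * T)"
    by (rule order_trans[rotated]) (simp add: E_def)
  then show ?thesis
    by (simp add: E_def z_def q_def)
qed

text \<open>Multiplying by the integrating factor \<open>exp (- W t)\<close> freezes
  \<open>Y\<close>, so it keeps the sign of \<open>Y 0\<close>. Applied to the variation of the
  flow, this expresses that neighbouring characteristics do not meet.\<close>

lemma linear_ode_pos:
  fixes Y k :: "real \<Rightarrow> real"
  assumes T: "0 \<le> T" and k: "continuous_on {0..T} k" and Y0: "Y 0 > 0"
    and D: "\<And>t. t \<in> {0..T} \<Longrightarrow> (Y has_real_derivative k t * Y t) (at t within {0..T})"
  shows "Y T > 0"
proof -
  define W where "W t = integral {0..t} k" for t
  have W: "(W has_real_derivative k t) (at t within {0..T})" if "t \<in> {0..T}" for t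
    unfolding W_def using that k by (rule integral_has_real_derivative[rotated])
  have "((\<lambda>t. Y t * exp (- W t)) has_real_derivative 0) (at t within {0..T})" if t: "t \<in> {0..T}" for t
    by (auto intro!: derivative_eq_intros D[OF t] W[OF t] simp: algebra_simps)
  then obtain c where c: "\<And>t. t \<in> {0..T} \<Longrightarrow> Y t * exp (- W t) = c"
    using has_field_derivative_zero_constant[of "{0..T}" "\<lambda>t. Y t * exp (- W t)"] by auto
  have "Y T * exp (- W T) = Y 0 * exp (- W 0)"
    using c[of 0] c[of T] T by simp
  also have "\<dots> > 0"
    using Y0 by simp
  finally show ?thesis
    by (simp add: zero_less_mult_iff)
qed

section \<open>Variation of the flow with respect to the initial radius\<close>

lemma has_real_derivative_cong_tangent:
  fixes f g :: "real \<Rightarrow> real"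
  assumes f: "(f has_real_derivative D) (at 0 within {0..})"
    and g: "(g has_real_derivative D') (at 0 within {0..})"
    and fg: "((\<lambda>h. (f h - g h) / h) \<longlongrightarrow> 0) (at 0 within {0..})"
    and eq: "f 0 = g 0"
  shows "D = D'"
proof -
  have "((\<lambda>h. f h - g h) has_real_derivative D - D') (at 0 within {0..})"
    by (intro DERIV_diff f g)
  then have "((\<lambda>h. (f h - g h) / h) \<longlongrightarrow> D - D') (at 0 within {0..})"
    using eq by (simp add: has_field_derivative_iff)
  moreover have "at (0::real) within {0..} \<noteq> bot"
    by (simp add: at_within_Ici_at_right)
  ultimately show ?thesis
    using fg tendsto_unique by fastforce
qed

text \<open>The curves \<open>x h\<close> match the initial velocity and mass only up to
  \<open>o(h)\<close>. The deviation estimate carries this to time \<open>t\<close> with a constant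
  uniform in \<open>h\<close>, so \<open>v t (x h t)\<close> and \<open>y h t\<close> have the same
  \<open>h\<close>-derivative at 0, which is the claim.\<close>

lemma variation_along_flow:
  fixes x y :: "real \<Rightarrow> real \<Rightarrow> real" and \<mu> :: "real \<Rightarrow> real"
  assumes C1m: "has_C1_partials m mt mr" and C1v: "has_C1_partials v vt vr"
    and meq: "\<And>t r. t \<ge> 0 \<Longrightarrow> r > 0 \<Longrightarrow> mt t r + v t r * mr t r = 0"
    and veq: "\<And>t r. t \<ge> 0 \<Longrightarrow> r > 0 \<Longrightarrow> vt t r + v t r * vr t r = a * m t r / r ^ p"
    and t: "0 \<le> t" and a: "0 \<le> a"
    and xt: "\<And>h s. h \<ge> 0 \<Longrightarrow> s \<ge> 0 \<Longrightarrow> (x h has_real_derivative y h s) (at s)"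
    and yt: "\<And>h s. h \<ge> 0 \<Longrightarrow> s \<ge> 0 \<Longrightarrow> (y h has_real_derivative a * \<mu> h / x h s ^ p) (at s)"
    and pos: "\<And>h s. h \<ge> 0 \<Longrightarrow> s \<ge> 0 \<Longrightarrow> x h s > 0"
    and cont: "continuous_on ({0..1} \<times> {0..t}) (\<lambda>(h, s). x h s)"
    and xh: "\<And>s. s \<ge> 0 \<Longrightarrow> ((\<lambda>h. x h s) has_real_derivative Y s) (at 0 within {0..})"
    and yh: "\<And>s. s \<ge> 0 \<Longrightarrow> ((\<lambda>h. y h s) has_real_derivative Z s) (at 0 within {0..})"
    and \<mu>h: "(\<mu> has_real_derivative mr 0 (x 0 0) * Y 0) (at 0 within {0..})"
    and init: "y 0 0 = v 0 (x 0 0)" "\<mu> 0 = m 0 (x 0 0)" "Z 0 = vr 0 (x 0 0) * Y 0"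
  shows "Z t = vr t (x 0 t) * Y t"
proof -
  \<comment> \<open>This is the expression bounded by \<open>K\<close> in
    \<open>trajectory_deviation\<close>; compactness of the parameter rectangle makes one
    \<open>K\<close> serve all \<open>h\<close> in \<open>{0..1}\<close>.\<close>
  define k where "k = (\<lambda>(h, s). 2 * \<bar>vr s (x h s)\<bar> + \<bar>mr s (x h s)\<bar> + a / x h s ^ p)"
  have "continuous_on ({0..1} \<times> {0..t}) k"
  proof -
    have *: "continuous_on ({0..1} \<times> {0..t}) (\<lambda>(h, s). (s, x h s))"
      using cont by (auto simp: case_prod_unfold intro!: continuous_intros)
    have "continuous_on ({0..1} \<times> {0..t}) (\<lambda>z. (\<lambda>(t, r). vr t r) ((\<lambda>(h, s). (s, x h s)) z))"
      by (rule continuous_on_compose2[OF _ *, of "{0..} \<times> {0<..}"])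
        (use C1v pos in \<open>auto simp: has_C1_partials_def\<close>)
    moreover have "continuous_on ({0..1} \<times> {0..t}) (\<lambda>z. (\<lambda>(t, r). mr t r) ((\<lambda>(h, s). (s, x h s)) z))"
      by (rule continuous_on_compose2[OF _ *, of "{0..} \<times> {0<..}"])
        (use C1m pos in \<open>auto simp: has_C1_partials_def\<close>)
    ultimately show ?thesis
      unfolding k_def using cont pos
      by (auto simp: case_prod_unfold less_imp_neq[symmetric] intro!: continuous_intros)
  qed
  then have "bounded (k ` ({0..1} \<times> {0..t}))"
    by (intro compact_imp_bounded compact_continuous_image) (auto intro: compact_Times)
  then obtain K where K: "\<And>h s. h \<in> {0..1} \<Longrightarrow> s \<in> {0..t} \<Longrightarrow> k (h, s) \<le> K"
    by (fastforce simp: bounded_iff abs_le_iff)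
  define z where "z h = v 0 (x h 0) - y h 0" for h
  define q where "q h = m 0 (x h 0) - \<mu> h" for h
  have dev: "\<bar>v t (x h t) - y h t\<bar> \<le> sqrt (((z h)\<^sup>2 + (q h)\<^sup>2) * exp (K * t))" if h: "h \<in> {0..1}" for h
  proof -
    have "(v t (x h t) - y h t)\<^sup>2 \<le> ((v 0 (x h 0) - y h 0)\<^sup>2 + (m 0 (x h 0) - \<mu> h)\<^sup>2) * exp (K * t)"
      using h K[OF h]
      by (intro trajectory_deviation[OF C1m C1v meq veq t a, where x = "x h" and y = "y h"])
        (auto intro: has_field_derivative_at_within xt yt pos simp: k_def)
    then show ?thesis
      by (simp add: z_def q_def real_le_rsqrt)
  qed
  have x0: "x 0 0 > 0" "x 0 t > 0"
    using pos t by auto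
  have vx: "((\<lambda>h. v s (x h s)) has_real_derivative vr s (x 0 s) * Y s) (at 0 within {0..})"
    if "s \<ge> 0" for s
    using C1v pos[of 0 s] that
    by (intro DERIV_chain2[OF _ xh]) (auto simp: has_C1_partials_def)
  have mx: "((\<lambda>h. m 0 (x h 0)) has_real_derivative mr 0 (x 0 0) * Y 0) (at 0 within {0..})"
    using C1m x0 by (intro DERIV_chain2[OF _ xh]) (auto simp: has_C1_partials_def)
  have "(z has_real_derivative 0) (at 0 within {0..})"
    unfolding z_def using DERIV_diff[OF vx yh, of 0 0] init by simp
  then have z: "((\<lambda>h. z h / h) \<longlongrightarrow> 0) (at 0 within {0..})"
    using init by (simp add: has_field_derivative_iff z_def)
  have "(q has_real_derivative 0) (at 0 within {0..})"
    unfolding q_def using DERIV_diff[OF mx \<mu>h] by simp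
  then have q: "((\<lambda>h. q h / h) \<longlongrightarrow> 0) (at 0 within {0..})"
    using init by (simp add: has_field_derivative_iff q_def)
  \<comment> \<open>The bound in \<open>dev\<close> is homogeneous of degree one in the defects, so
    dividing by \<open>h\<close> leaves only their difference quotients, which vanish in the
    limit.\<close>
  have lim: "((\<lambda>h. sqrt (((z h / h)\<^sup>2 + (q h / h)\<^sup>2) * exp (K * t))) \<longlongrightarrow> sqrt ((0\<^sup>2 + 0\<^sup>2) * exp (K * t)))
      (at 0 within {0..})"
    by (intro tendsto_intros z q)
  have "((\<lambda>h. (v t (x h t) - y h t) / h) \<longlongrightarrow> 0) (at 0 within {0..})"
  proof (rule Lim_null_comparison)
    show "\<forall>\<^sub>F h in at 0 within {0..}. norm ((v t (x h t) - y h t) / h)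
        \<le> sqrt (((z h / h)\<^sup>2 + (q h / h)\<^sup>2) * exp (K * t))"
      unfolding eventually_at
    proof (intro exI[of _ 1] conjI ballI impI)
      fix h :: real
      assume "h \<in> {0..}" "h \<noteq> 0 \<and> dist h 0 < 1"
      then have h: "0 < h" "h \<le> 1"
        by (auto simp: dist_real_def)
      have "((z h / h)\<^sup>2 + (q h / h)\<^sup>2) * exp (K * t) = ((z h)\<^sup>2 + (q h)\<^sup>2) * exp (K * t) / h\<^sup>2"
        using h by (simp add: power_divide add_divide_distrib[symmetric])
      then show "norm ((v t (x h t) - y h t) / h)
        \<le> sqrt (((z h / h)\<^sup>2 + (q h / h)\<^sup>2) * exp (K * t))"
        using dev[of h] h by (simp add: real_sqrt_divide divide_right_mono)
    qed simp
    show "((\<lambda>h. sqrt (((z h / h)\<^sup>2 + (q h / h)\<^sup>2) * exp (K * t))) \<longlongrightarrow> 0) (at 0 within {0..})"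
      using lim by simp
  qed
  moreover have "v t (x 0 t) = y 0 t"
    using dev[of 0] init by (simp add: z_def q_def)
  ultimately show ?thesis
    using has_real_derivative_cong_tangent[OF vx[OF t] yh[OF t]] by simp
qed

text \<open>The family of curves starts at \<open>(R + h) * \<xi> (\<kappa> * h)\<close> rather than at \<open>R + h\<close>: the time shift makes the
  initial velocity match \<open>v\<close> to first order in \<open>h\<close> while the curves stay exact solutions.\<close>

lemma no_turning:
  fixes m v :: "real \<Rightarrow> real \<Rightarrow> real" and \<xi> u :: "real \<Rightarrow> real"
  assumes C1m: "has_C1_partials m mt mr" and C1v: "has_C1_partials v vt vr"
    and meq: "\<And>t r. t \<ge> 0 \<Longrightarrow> r > 0 \<Longrightarrow> mt t r + v t r * mr t r = 0"
    and veq: "\<And>t r. t \<ge> 0 \<Longrightarrow> r > 0 \<Longrightarrow> vt t r + v t r * vr t r = a * m t r / r ^ p"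
    and a: "0 < a" and R: "R > 0" and M: "m 0 R > 0" and mr: "mr 0 R \<ge> 0" and v0: "v 0 R = 0"
    and \<xi>: "\<And>t. (\<xi> has_real_derivative u t) (at t)"
    and u: "\<And>t. (u has_real_derivative 1 / \<xi> t ^ p) (at t)"
    and init: "\<xi> 0 = 1" "u 0 = 0" and \<xi>_pos: "\<And>t. \<xi> t > 0"
    and \<tau>: "\<tau> \<ge> 0"
  shows "\<xi> \<tau> - real (Suc p) / 2 * \<tau> * u \<tau> + R * mr 0 R / (2 * m 0 R) * \<tau> * u \<tau>
    + vr 0 R / sqrt (a * m 0 R / R ^ Suc p) * u \<tau> > 0"
proof -
  define M where "M = m 0 R"
  define \<omega> where "\<omega> = sqrt (a * M / R ^ Suc p)"
  \<comment> \<open>The initial mass is replaced by its linearization at \<open>R\<close>, which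
    suffices for a first-order variation. It stays positive for every \<open>h \<ge> 0\<close>
    because \<open>mr 0 R \<ge> 0\<close>, hence the one-sided derivatives in
    \<open>h\<close>.\<close>
  define \<mu> where "\<mu> h = M + h * mr 0 R" for h
  \<comment> \<open>By scaling, \<open>(R + h) * \<xi> (\<Omega> h * s)\<close> solves the equation
    with mass \<open>\<mu> h\<close> exactly for this frequency; \<open>\<Omega>'\<close> is its
    derivative at \<open>h = 0\<close>.\<close>
  define \<Omega> where "\<Omega> h = sqrt (a * \<mu> h / (R + h) ^ Suc p)" for h
  define \<Omega>' where "\<Omega>' = \<omega> / 2 * (mr 0 R / M - real (Suc p) / R)"
  \<comment> \<open>At time 0 the variations are \<open>Y 0 = 1\<close> and
    \<open>Z 0 = R * \<omega> * \<kappa>\<close>; requiring \<open>Z 0 = vr 0 R\<close> fixes the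
    shift.\<close>
  define \<kappa> where "\<kappa> = vr 0 R / (R * \<omega>)"
  define x where "x h s = (R + h) * \<xi> (\<Omega> h * s + \<kappa> * h)" for h s
  define y where "y h s = (R + h) * \<Omega> h * u (\<Omega> h * s + \<kappa> * h)" for h s
  define Y where "Y s = \<xi> (\<omega> * s) + R * u (\<omega> * s) * (\<Omega>' * s + \<kappa>)" for s
  define Z where "Z s = (\<omega> + R * \<Omega>') * u (\<omega> * s) + R * \<omega> / \<xi> (\<omega> * s) ^ p * (\<Omega>' * s + \<kappa>)" for s
  have Mpos: "M > 0" using M by (simp add: M_def)
  have \<mu>_pos: "\<mu> h > 0" if "h \<ge> 0" for h
    using that Mpos mr by (simp add: \<mu>_def add_pos_nonneg)
  have \<omega>: "\<omega> > 0" "\<omega>\<^sup>2 = a * M / R ^ Suc p"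
    using a Mpos R by (simp_all add: \<omega>_def)
  have \<Omega>0: "\<Omega> 0 = \<omega>"
    by (simp add: \<Omega>_def \<omega>_def \<mu>_def)
  have \<Omega>_sq: "(\<Omega> h)\<^sup>2 = a * \<mu> h / (R + h) ^ Suc p" if "h \<ge> 0" for h
    using that a R \<mu>_pos[OF that] by (simp add: \<Omega>_def)
  have D\<Omega>: "(\<Omega> has_real_derivative \<Omega>') (at 0 within {0..})"
  proof -
    have quot: "((\<lambda>h. a * \<mu> h / (R + h) ^ Suc p) has_real_derivative
        a * M / R ^ Suc p * (mr 0 R / M - real (Suc p) / R)) (at 0 within {0..})"
    proof -
      have "((\<lambda>h. (R + h) ^ Suc p) has_real_derivative real (Suc p) * R ^ p) (at 0 within {0..})"
      proof -
        have "((\<lambda>h. R + h) has_real_derivative 1) (at 0 within {0..})"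
          by (auto intro!: derivative_eq_intros)
        from DERIV_power[OF this, of "Suc p"] show ?thesis
          by (simp del: power_Suc)
      qed
      moreover have "((\<lambda>h. a * \<mu> h) has_real_derivative a * mr 0 R) (at 0 within {0..})"
        unfolding \<mu>_def by (auto intro!: derivative_eq_intros)
      ultimately have "((\<lambda>h. a * \<mu> h / (R + h) ^ Suc p) has_real_derivative
          (a * mr 0 R * (R + 0) ^ Suc p - a * \<mu> 0 * (real (Suc p) * R ^ p))
            / ((R + 0) ^ Suc p * (R + 0) ^ Suc p)) (at 0 within {0..})"
        using R by (intro DERIV_divide) auto
      also have "(a * mr 0 R * (R + 0) ^ Suc p - a * \<mu> 0 * (real (Suc p) * R ^ p))
            / ((R + 0) ^ Suc p * (R + 0) ^ Suc p)
          = a * M / R ^ Suc p * (mr 0 R / M - real (Suc p) / R)"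
        using R Mpos by (simp add: \<mu>_def field_simps)
      finally show ?thesis .
    qed
    have "(sqrt has_real_derivative inverse \<omega> / 2) (at (a * \<mu> 0 / (R + 0) ^ Suc p))"
      using DERIV_real_sqrt[of "a * M / R ^ Suc p"] a Mpos R by (simp add: \<omega>_def \<mu>_def)
    from DERIV_chain2[OF this quot] have "(\<Omega> has_real_derivative inverse \<omega> / 2 * (a * M / R ^ Suc p * (mr 0 R / M - real (Suc p) / R)))
        (at 0 within {0..})"
      unfolding \<Omega>_def[abs_def] .
    then have "(\<Omega> has_real_derivative inverse \<omega> / 2 * (\<omega>\<^sup>2 * (mr 0 R / M - real (Suc p) / R)))
        (at 0 within {0..})"
      by (simp only: \<omega>(2))
    then show ?thesis
      using \<omega>(1) by (simp add: \<Omega>'_def power2_eq_square mult.assoc[symmetric])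
  qed
  have x_pos: "x h s > 0" if "h \<ge> 0" for h s
    using that R \<xi>_pos by (simp add: x_def)
  have var: "Z s = vr s (x 0 s) * Y s" if s: "s \<ge> 0" for s
  proof (rule variation_along_flow[OF C1m C1v meq veq s, where y = y and \<mu> = \<mu>])
    show "(x h has_real_derivative y h s) (at s)" for h s
      unfolding x_def[abs_def] y_def
      by (auto intro!: derivative_eq_intros DERIV_chain2[OF \<xi>])
    show "(y h has_real_derivative a * \<mu> h / x h s ^ p) (at s)" if "h \<ge> 0" for h s
    proof -
      have "(y h has_real_derivative (R + h) * \<Omega> h * (1 / \<xi> (\<Omega> h * s + \<kappa> * h) ^ p * \<Omega> h)) (at s)"
        unfolding y_def[abs_def]
        by (auto intro!: derivative_eq_intros DERIV_chain2[OF u])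
      also have "(R + h) * \<Omega> h * (1 / \<xi> (\<Omega> h * s + \<kappa> * h) ^ p * \<Omega> h)
          = (R + h) * (\<Omega> h)\<^sup>2 / \<xi> (\<Omega> h * s + \<kappa> * h) ^ p"
        by (simp add: power2_eq_square)
      also have "\<dots> = a * \<mu> h / x h s ^ p"
        unfolding \<Omega>_sq[OF that] using R that by (simp add: x_def power_mult_distrib)
      finally show ?thesis .
    qed
    show "continuous_on ({0..1} \<times> {0..s}) (\<lambda>(h, s). x h s)"
    proof -
      have \<xi>': "continuous_on UNIV \<xi>"
        using \<xi> by (meson DERIV_isCont continuous_at_imp_continuous_on)
      show ?thesis
        unfolding x_def \<Omega>_def \<mu>_def case_prod_unfold using R
        by (auto intro!: continuous_intros continuous_on_compose2[OF \<xi>'])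
    qed
    show "((\<lambda>h. x h s) has_real_derivative Y s) (at 0 within {0..})" for s
      unfolding x_def Y_def
      by (auto intro!: derivative_eq_intros DERIV_chain2[OF \<xi>] D\<Omega> simp: \<Omega>0 algebra_simps)
    show "((\<lambda>h. y h s) has_real_derivative Z s) (at 0 within {0..})" for s
      unfolding y_def Z_def
      by (auto intro!: derivative_eq_intros DERIV_chain2[OF u] D\<Omega> simp: \<Omega>0 algebra_simps)
    show "(\<mu> has_real_derivative mr 0 (x 0 0) * Y 0) (at 0 within {0..})"
      unfolding \<mu>_def[abs_def] by (auto intro!: derivative_eq_intros simp: x_def Y_def init)
    show "y 0 0 = v 0 (x 0 0)" "\<mu> 0 = m 0 (x 0 0)" "Z 0 = vr 0 (x 0 0) * Y 0"
      using R \<omega>(1) by (simp_all add: y_def x_def \<mu>_def Z_def Y_def init v0 M_def \<kappa>_def)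
  qed (use a x_pos in auto)
  \<comment> \<open>The derivative of \<open>Y\<close> is \<open>Z\<close>, so \<open>var\<close>
    turns into a linear equation for \<open>Y\<close> along the central curve. The time
    \<open>\<tau> / \<omega>\<close> corresponds to profile time \<open>\<tau>\<close>.\<close>
  have "Y (\<tau> / \<omega>) > 0"
  proof (rule linear_ode_pos[where Y = Y and T = "\<tau> / \<omega>" and k = "\<lambda>s. vr s (x 0 s)"])
    show "0 \<le> \<tau> / \<omega>" using \<tau> \<omega> by simp
    have "continuous_on {0..\<tau> / \<omega>} (\<lambda>s. (\<lambda>(t, r). vr t r) (s, x 0 s))"
    proof (rule continuous_on_compose2[where t = "{0..} \<times> {0<..}" and g = "\<lambda>(t, r). vr t r"])
      show "continuous_on ({0..} \<times> {0<..}) (\<lambda>(t, r). vr t r)"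
        using C1v by (simp add: has_C1_partials_def)
      have \<xi>': "continuous_on UNIV \<xi>"
        using \<xi> by (meson DERIV_isCont continuous_at_imp_continuous_on)
      show "continuous_on {0..\<tau> / \<omega>} (\<lambda>s. (s, x 0 s))"
        unfolding x_def by (auto intro!: continuous_intros continuous_on_compose2[OF \<xi>'])
    qed (use x_pos in auto)
    then show "continuous_on {0..\<tau> / \<omega>} (\<lambda>s. vr s (x 0 s))"
      by simp
    show "Y 0 > 0" by (simp add: Y_def init)
    fix s assume s: "s \<in> {0..\<tau> / \<omega>}"
    have "(Y has_real_derivative Z s) (at s within {0..\<tau> / \<omega>})"
      unfolding Y_def[abs_def] Z_def
      by (auto intro!: derivative_eq_intros DERIV_chain2[OF u] DERIV_chain2[OF \<xi>] simp: algebra_simps add_divide_distrib)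
    then show "(Y has_real_derivative vr s (x 0 s) * Y s) (at s within {0..\<tau> / \<omega>})"
      using var[of s] s by simp
  qed
  also have "Y (\<tau> / \<omega>) = \<xi> \<tau> + u \<tau> * (R * \<Omega>' * \<tau> / \<omega> + R * \<kappa>)"
    using \<omega>(1) by (simp add: Y_def algebra_simps)
  also have "R * \<Omega>' * \<tau> / \<omega> = R * mr 0 R / (2 * M) * \<tau> - real (Suc p) / 2 * \<tau>"
    using R \<omega>(1) Mpos by (simp add: \<Omega>'_def field_simps)
  also have "R * \<kappa> = vr 0 R / \<omega>"
    using R by (simp add: \<kappa>_def)
  finally show ?thesis
    by (simp add: \<omega>_def M_def algebra_simps)
qed

section \<open>From a global solution to the contradiction\<close>

text \<open>The flux identity replaces the potential by the mass, which gives the setting of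
  \<open>no_turning\<close> with \<open>a = - lam\<close> and \<open>p = n - 1\<close>. At time 0
  the partials \<open>mr\<close> and \<open>vr\<close> are then expressed through
  \<open>\<rho>0\<close> and \<open>v0\<close>.\<close>

lemma global_solution_no_turning:
  fixes \<xi> u :: "real \<Rightarrow> real"
  assumes sol: "global_classical_solution n lam \<rho>0 v0 \<rho> v \<Phi>"
    and lam: "lam < 0" and n: "n \<ge> 2"
    and \<rho>0: "\<rho>0 \<in> D0" "\<rho>0 R \<ge> 0" and R: "R > 0"
    and M: "integral {0..R} (\<lambda>s. \<rho>0 s * s ^ (n - 1)) = M" "M > 0" and v0: "v0 R = 0"
    and \<xi>: "\<And>t. (\<xi> has_real_derivative u t) (at t)"
    and u: "\<And>t. (u has_real_derivative 1 / \<xi> t ^ (n - 1)) (at t)"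
    and init: "\<xi> 0 = 1" "u 0 = 0" and \<xi>_pos: "\<And>t. \<xi> t > 0"
    and \<tau>: "\<tau> \<ge> 0"
  shows "\<xi> \<tau> - real n / 2 * \<tau> * u \<tau> + R ^ n * \<rho>0 R / (2 * M) * \<tau> * u \<tau>
    + deriv v0 R / sqrt (- lam * M / R ^ n) * u \<tau> > 0"
proof -
  obtain mt mr vt vr where
    C1m: "has_C1_partials (mass n \<rho>) mt mr" and C1v: "has_C1_partials v vt vr" and
    meq: "\<And>t r. t \<ge> 0 \<Longrightarrow> r > 0 \<Longrightarrow> mt t r + v t r * mr t r = 0" and
    veq: "\<And>t r. t \<ge> 0 \<Longrightarrow> r > 0 \<Longrightarrow> vt t r + v t r * vr t r + lam * deriv (\<Phi> t) r = 0"
    using sol unfolding global_classical_solution_def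
    by (elim conjE exE) (rule that, assumption, assumption, simp_all)
  have \<rho>_init: "\<rho> 0 r = \<rho>0 r" "v 0 r = v0 r" if "r \<ge> 0" for r
    using sol that by (auto simp: global_classical_solution_def)
  have n': "Suc (n - 1) = n"
    using n by simp
  have field: "r ^ (n - 1) * deriv (\<Phi> t) r = mass n \<rho> t r" if "t \<ge> 0" "r > 0" for t r
    unfolding mass_def
  proof (rule radial_poisson_flux)
    show "\<Phi> t \<in> D2" "1 \<le> n - 1" "r > 0"
      using sol that n by (auto simp: global_classical_solution_def)
    show "(\<lambda>s. \<rho> t s * s ^ (n - 1)) integrable_on {0..r}" if "r > 0" for r
      using sol that \<open>t \<ge> 0\<close>
      by (auto simp: global_classical_solution_def intro: set_lebesgue_integral_eq_integral(1))
    show "((\<lambda>s. s ^ (n - 1) * deriv (\<Phi> t) s) has_real_derivative \<rho> t r * r ^ (n - 1)) (at r)"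
      if "r > 0" for r
      using sol that \<open>t \<ge> 0\<close> by (auto simp: global_classical_solution_def mult.commute)
  qed
  have veq': "vt t r + v t r * vr t r = - lam * mass n \<rho> t r / r ^ (n - 1)" if "t \<ge> 0" "r > 0" for t r
    using veq[OF that] field[OF that, symmetric] that by simp
  have mass0: "mass n \<rho> 0 r = integral {0..r} (\<lambda>s. \<rho>0 s * s ^ (n - 1))" for r
    unfolding mass_def by (rule integral_cong) (auto simp: \<rho>_init)
  have mr0: "mr 0 R = \<rho>0 R * R ^ (n - 1)"
  proof -
    \<comment> \<open>The interval reaches beyond \<open>R\<close> so that \<open>R\<close> is
      interior and the derivative becomes two-sided.\<close>
    have "((\<lambda>r. integral {0..r} (\<lambda>s. \<rho>0 s * s ^ (n - 1))) has_real_derivative \<rho>0 R * R ^ (n - 1))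
        (at R within {0..R + 1})"
      using \<rho>0 R
      by (intro integral_has_real_derivative continuous_intros)
        (auto simp: D0_def intro: continuous_on_subset)
    then have "(mass n \<rho> 0 has_real_derivative \<rho>0 R * R ^ (n - 1)) (at R)"
      using R unfolding mass0[abs_def] by (simp add: at_within_Icc_at)
    moreover have "(mass n \<rho> 0 has_real_derivative mr 0 R) (at R)"
      using C1m R by (simp add: has_C1_partials_def)
    ultimately show ?thesis
      using DERIV_unique by blast
  qed
  have vr0: "vr 0 R = deriv v0 R"
  proof -
    have "(v 0 has_real_derivative vr 0 R) (at R)"
      using C1v R by (simp add: has_C1_partials_def)
    then have "(v0 has_real_derivative vr 0 R) (at R)"
      by (rule has_field_derivative_transform_within_open[where S = "{0<..}"])
        (use R \<rho>_init in auto)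
    then show ?thesis
      by (simp add: DERIV_imp_deriv)
  qed
  have "\<xi> \<tau> - real (Suc (n - 1)) / 2 * \<tau> * u \<tau> + R * mr 0 R / (2 * mass n \<rho> 0 R) * \<tau> * u \<tau>
    + vr 0 R / sqrt (- lam * mass n \<rho> 0 R / R ^ Suc (n - 1)) * u \<tau> > 0"
    using lam R M v0 \<rho>0(2) \<rho>_init(2)[of R]
    by (intro no_turning[OF C1m C1v meq veq' _ R _ _ _ \<xi> u init \<xi>_pos \<tau>])
      (auto simp: mass0 mr0)
  moreover have "R * mr 0 R = R ^ n * \<rho>0 R"
    using n' by (metis mr0 mult.assoc mult.commute power_Suc)
  ultimately show ?thesis
    unfolding n' vr0 mass0 M by simp
qed

text \<open>Nonnegative density makes the mass nondecreasing, and continuity makes it positive once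
  the ball contains a point of nonzero density; the mass of such a ball is the lower bound.\<close>

lemma initial_mass_eventually_ge:
  assumes \<rho>0: "\<rho>0 \<in> D0" and nonneg: "\<forall>x\<ge>0. \<rho>0 x \<ge> 0" and nz: "\<exists>x\<ge>0. \<rho>0 x \<noteq> 0"
  obtains b \<mu> :: real where "\<mu> > 0" "\<And>R. R \<ge> b \<Longrightarrow> integral {0..R} (\<lambda>s. \<rho>0 s * s ^ p) \<ge> \<mu>"
proof -
  let ?g = "\<lambda>s. \<rho>0 s * s ^ p"
  have cont: "continuous_on {0..} \<rho>0"
    using \<rho>0 by (simp add: D0_def)
  \<comment> \<open>The point is taken away from 0, where the weight \<open>s ^ p\<close> may
    vanish; if the density were zero on \<open>{0<..}\<close>, continuity would make it zero at 0 as
    well.\<close>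
  obtain x where x: "x > 0" "\<rho>0 x \<noteq> 0"
  proof (rule ccontr)
    assume "\<not> thesis"
    then have "\<rho>0 x = 0" if "x \<in> {0<..}" for x
      using that \<open>\<And>x. 0 < x \<Longrightarrow> \<rho>0 x \<noteq> 0 \<Longrightarrow> thesis\<close> by auto
    then have "\<rho>0 x = 0" if "x \<ge> 0" for x
      using continuous_constant_on_closure[of "{0<..}" \<rho>0 0 x] cont that by simp
    then show False using nz by blast
  qed
  have g: "continuous_on {0..R} ?g" for R
    by (intro continuous_intros continuous_on_subset[OF cont]) auto
  have g_int: "?g integrable_on {0..R}" for R
    by (intro integrable_continuous_interval g)
  have mono: "integral {0..a} ?g \<le> integral {0..b} ?g" if "a \<le> b" for a b
    by (rule integral_subset_le) (use that nonneg g_int in auto)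
  have "integral {0..x + 1} ?g \<noteq> 0"
  proof
    assume "integral {0..x + 1} ?g = 0"
    then have "(?g has_integral 0) (cbox 0 (x + 1))"
      using g_int[of "x + 1"] by (metis integrable_integral interval_cbox)
    then have "?g x = 0"
      using g[of "x + 1"] x nonneg by (intro has_integral_0_cbox_imp_0[of 0 "x + 1" ?g]) auto
    then show False using x by simp
  qed
  moreover have "integral {0..x + 1} ?g \<ge> 0"
    using nonneg by (intro integral_nonneg g_int) auto
  ultimately show ?thesis
    using mono by (intro that[of "integral {0..x + 1} ?g" "x + 1"]) auto
qed

theorem corollary1p19:
  fixes n :: nat and lam :: real and \<rho>0 v0 :: "real \<Rightarrow> real" and r :: "nat \<Rightarrow> real"
  assumes "lam < 0" and "n \<ge> 2"
    and "\<rho>0 \<in> D0" and "\<forall>x\<ge>0. \<rho>0 x \<ge> 0" and "\<exists>x\<ge>0. \<rho>0 x \<noteq> 0"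
    and "v0 \<in> D1" and "v0 0 = 0"
    and "\<forall>j\<ge>1. r j > 0"
    and "filterlim r at_top sequentially"
    and "\<forall>j\<ge>1. v0 (r j) = 0"
    and "limsup (\<lambda>j. ereal (r j * deriv v0 (r j))) < \<infinity>"
    and "(\<lambda>j. r j ^ n * \<rho>0 (r j)) \<longlonglongrightarrow> 0"
  shows "breaks_down_in_finite_time n lam \<rho>0 v0"
  unfolding breaks_down_in_finite_time_def
proof
  assume "\<exists>\<rho> v \<Phi>. global_classical_solution n lam \<rho>0 v0 \<rho> v \<Phi>"
  then obtain \<rho> v \<Phi> where sol: "global_classical_solution n lam \<rho>0 v0 \<rho> v \<Phi>"
    by blast
  define M where "M R = integral {0..R} (\<lambda>s. \<rho>0 s * s ^ (n - 1))" for R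
  obtain b \<mu> where \<mu>: "\<mu> > 0" "\<And>R. R \<ge> b \<Longrightarrow> M R \<ge> \<mu>"
    using initial_mass_eventually_ge[OF assms(3-5)] unfolding M_def by blast
  have large: "\<forall>\<^sub>F j in sequentially. j \<ge> 1 \<and> r j \<ge> b"
    using assms(9) by (intro eventually_conj eventually_ge_at_top) (auto simp: filterlim_at_top)
  have small: "\<forall>\<^sub>F j in sequentially. r j ^ n * \<rho>0 (r j) < e" if "e > 0" for e
    using order_tendstoD(2)[OF assms(12) that] .
  have ratio: "r j ^ n * \<rho>0 (r j) / (2 * M (r j)) \<le> e"
    if "j \<ge> 1" "r j \<ge> b" "r j ^ n * \<rho>0 (r j) < 2 * \<mu> * e" "e > 0" for j e
  proof -
    have "2 * \<mu> * e \<le> 2 * M (r j) * e"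
      using \<mu>(2)[of "r j"] that by (intro mult_right_mono) auto
    then have "r j ^ n * \<rho>0 (r j) \<le> e * (2 * M (r j))"
      using that(3) by (simp only: mult.commute[of e])
    then show ?thesis
      using \<mu>(1) \<mu>(2)[of "r j"] that by (simp add: pos_divide_le_eq)
  qed
  show False
  proof (cases "n = 2")
    case True
    obtain \<xi> u :: "real \<Rightarrow> real" where prof:
      "\<And>t. (\<xi> has_real_derivative u t) (at t)"
      "\<And>t. (u has_real_derivative 1 / \<xi> t) (at t)"
      "\<xi> 0 = 1" "u 0 = 0" "\<And>t. \<xi> t > 0"
      "\<And>C. \<exists>t\<ge>0. u t \<ge> 0 \<and> \<xi> t - t * u t + C * u t < 0"
      using unit_profile_2 by blast
    obtain C where C: "limsup (\<lambda>j. ereal (r j * deriv v0 (r j))) < ereal C"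
      using ereal_dense2[OF assms(11)] by blast
    have slope: "\<forall>\<^sub>F j in sequentially. r j * deriv v0 (r j) < C"
      using Limsup_lessD[OF C] by simp
    \<comment> \<open>For \<open>n = 2\<close> the velocity coefficient equals
      \<open>R * deriv v0 R / sqrt (- lam * M R)\<close>, so \<open>C'\<close> bounds it for all
      large \<open>j\<close>. The absolute value is used because replacing \<open>M R\<close> by the
      smaller \<open>\<mu>\<close> increases the quotient only for a nonnegative numerator. Thus
      \<open>\<tau>\<close> can be fixed before \<open>j\<close>.\<close>
    define C' where "C' = \<bar>C\<bar> / sqrt (- lam * \<mu>)"
    obtain \<tau> where \<tau>: "\<tau> \<ge> 0" "u \<tau> \<ge> 0" "\<xi> \<tau> - \<tau> * u \<tau> + C' * u \<tau> < 0"
      using prof(6) by blast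
    define g where "g = - (\<xi> \<tau> - \<tau> * u \<tau> + C' * u \<tau>)"
    \<comment> \<open>The density term may use up at most the strict margin \<open>g\<close>; adding
      1 keeps the denominator positive.\<close>
    define e where "e = g / (\<tau> * u \<tau> + 1)"
    have g: "g > 0" using \<tau> by (simp add: g_def)
    have \<tau>u: "\<tau> * u \<tau> \<ge> 0" using \<tau> by simp
    have e: "e > 0" "e * (\<tau> * u \<tau>) \<le> g"
      using g \<tau>u by (auto simp: e_def field_simps)
    have "\<forall>\<^sub>F j in sequentially. (j \<ge> 1 \<and> r j \<ge> b) \<and> r j ^ n * \<rho>0 (r j) < 2 * \<mu> * e
        \<and> r j * deriv v0 (r j) < C"
      using e \<mu> by (intro eventually_conj large small slope) auto
    then obtain j where j: "j \<ge> 1" "r j \<ge> b" "r j ^ n * \<rho>0 (r j) < 2 * \<mu> * e"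
        "r j * deriv v0 (r j) < C"
      by (auto dest: eventually_happens)
    define R where "R = r j"
    have R: "R > 0" "v0 R = 0" "M R \<ge> \<mu>"
      using assms(8,10) j \<mu> by (auto simp: R_def)
    have "0 < \<xi> \<tau> - real n / 2 * \<tau> * u \<tau> + R ^ n * \<rho>0 R / (2 * M R) * \<tau> * u \<tau>
        + deriv v0 R / sqrt (- lam * M R / R ^ n) * u \<tau>"
      using global_solution_no_turning[OF sol assms(1,2,3) _ R(1) refl _ R(2) prof(1) _ prof(3,4,5) \<tau>(1)]
        prof(2) assms(4) R \<mu>(1) True by (simp add: M_def)
    moreover have "deriv v0 R / sqrt (- lam * M R / R ^ n) * u \<tau> \<le> C' * u \<tau>"
    proof (rule mult_right_mono[OF _ \<tau>(2)])
      have "deriv v0 R / sqrt (- lam * M R / R ^ n) = R * deriv v0 R / sqrt (- lam * M R)"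
      proof -
        have "sqrt (- lam * M R / R ^ n) = sqrt (- lam * M R) / R"
          unfolding True real_sqrt_divide using R(1) by simp
        then show ?thesis by (simp add: mult.commute)
      qed
      also have "\<dots> \<le> \<bar>C\<bar> / sqrt (- lam * M R)"
        using j(4) R \<mu>(1) assms(1) by (intro divide_right_mono) (auto simp: R_def mult_nonpos_nonneg)
      also have "\<dots> \<le> C'"
        unfolding C'_def using R \<mu>(1) assms(1)
        by (intro divide_left_mono real_sqrt_le_mono mult_left_mono mult_pos_pos)
          (auto simp: mult_neg_pos)
      finally show "deriv v0 R / sqrt (- lam * M R / R ^ n) \<le> C'" .
    qed
    moreover have "R ^ n * \<rho>0 R / (2 * M R) * \<tau> * u \<tau> \<le> e * (\<tau> * u \<tau>)"
      using mult_right_mono[OF ratio[OF j(1-3) e(1)] \<tau>u] by (simp add: R_def mult.assoc)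
    ultimately show False
      using e(2) True by (simp add: g_def)
  next
    case False
    then have n: "n \<ge> 3" using assms(2) by simp
    obtain \<xi> u :: "real \<Rightarrow> real" where prof:
      "\<And>t. (\<xi> has_real_derivative u t) (at t)"
      "\<And>t. (u has_real_derivative 1 / \<xi> t ^ (n - 1)) (at t)"
      "\<xi> 0 = 1" "u 0 = 0" "\<And>t. \<xi> t > 0"
      "\<And>C. \<exists>t\<ge>0. u t \<ge> 0 \<and> \<xi> t - 5 / 4 * t * u t + C * u t < 0"
      using unit_profile_ge_3[OF n] by blast
    \<comment> \<open>The bound 1/4 on the density coefficient leaves at least
      \<open>3 / 2 - 1 / 4 = 5 / 4\<close> of the coefficient \<open>n / 2\<close>.\<close>
    have "\<forall>\<^sub>F j in sequentially. (j \<ge> 1 \<and> r j \<ge> b) \<and> r j ^ n * \<rho>0 (r j) < 2 * \<mu> * (1 / 4)"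
      using \<mu> by (intro eventually_conj large small) auto
    then obtain j where j: "j \<ge> 1" "r j \<ge> b" "r j ^ n * \<rho>0 (r j) < 2 * \<mu> * (1 / 4)"
      by (auto dest: eventually_happens)
    define R where "R = r j"
    have R: "R > 0" "v0 R = 0" "M R \<ge> \<mu>"
      using assms(8,10) j \<mu> by (auto simp: R_def)
    \<comment> \<open>Here the radius is fixed first and its own velocity coefficient plays the role
      of \<open>C\<close>, so \<open>\<tau>\<close> depends on \<open>R\<close>.\<close>
    obtain \<tau> where \<tau>: "\<tau> \<ge> 0" "u \<tau> \<ge> 0"
      "\<xi> \<tau> - 5 / 4 * \<tau> * u \<tau> + deriv v0 R / sqrt (- lam * M R / R ^ n) * u \<tau> < 0"
      using prof(6) by blast
    have "0 < \<xi> \<tau> - real n / 2 * \<tau> * u \<tau> + R ^ n * \<rho>0 R / (2 * M R) * \<tau> * u \<tau>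
        + deriv v0 R / sqrt (- lam * M R / R ^ n) * u \<tau>"
      using global_solution_no_turning[OF sol assms(1,2,3) _ R(1) refl _ R(2) prof(1-5) \<tau>(1)]
        assms(4) R \<mu>(1) by (simp add: M_def)
    moreover have "(R ^ n * \<rho>0 R / (2 * M R) - real n / 2) * (\<tau> * u \<tau>) \<le> - (5 / 4) * (\<tau> * u \<tau>)"
    proof (rule mult_right_mono)
      have "R ^ n * \<rho>0 R / (2 * M R) \<le> 1 / 4"
        unfolding R_def by (rule ratio[OF j]) simp
      moreover have "real n \<ge> 3"
        using n by simp
      ultimately show "R ^ n * \<rho>0 R / (2 * M R) - real n / 2 \<le> - (5 / 4)"
        by argo
    qed (use \<tau> in simp)
    then have "R ^ n * \<rho>0 R / (2 * M R) * \<tau> * u \<tau> - real n / 2 * \<tau> * u \<tau> \<le> - (5 / 4 * \<tau> * u \<tau>)"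
      by (simp only: left_diff_distrib mult.assoc mult_minus_left)
    ultimately show False
      using \<tau>(3) by argo
  qed
qed

end
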